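(* Let $\varrho\in(-1,1)$, $\varrho\neq 0$, and let $\alpha,\beta,\gamma\in(-1,1)$ satisfy $\alpha\beta\gamma=\varrho$. Then for all $u,v\in(0,1)$, \begin{align*} C(u,v;\varrho) &=\int_{-\infty}^{\infty}\int_{-\infty}^{\infty}\Phi\left(\frac{\Phi^{-1}(u)-\alpha x}{\sqrt{1-\alpha^2}}\right)\Phi\left(\frac{\Phi^{-1}(v)-\beta y}{\sqrt{1-\beta^2}}\right)\varphi_2(x,y;\gamma)\,dy\,dx\\ &=\int_0^1\int_0^1\Phi\left(\frac{\Phi^{-1}(u)-\alpha\,\Phi^{-1}(s)}{\sqrt{1-\alpha^2}}\right)\Phi\left(\frac{\Phi^{-1}(v)-\beta\,\Phi^{-1}(t)}{\sqrt{1-\beta^2}}\right)c(s,t;\gamma)\,dt\,ds\\ &=\int_0^1\int_0^1\left(\frac{\partial}{\partial s}C(u,s;\alpha)\right)\left(\frac{\partial}{\partial t}C(t,v;\beta)\right)c(s,t;\gamma)\,dt\,ds. \end{align*}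
   Context: $\varphi(x)=\frac{1}{\sqrt{2\pi}}e^{-x^2/2}$ and $\Phi(h)=\int_{-\infty}^h\varphi(x)\,dx$ are the standard normal density and distribution function. For $\varrho\in(-1,1)$, $$\varphi_2(x,y;\varrho)=\frac{1}{2\pi\sqrt{1-\varrho^2}}\exp\left(-\frac{x^2-2\varrho xy+y^2}{2(1-\varrho^2)}\right),\qquad \Phi_2(h,k;\varrho)=\int_{-\infty}^h\int_{-\infty}^k\varphi_2(x,y;\varrho)\,dy\,dx$$ are the density and distribution function of the bivariate standard normal distribution with correlation $\varrho$. The bivariate normal copula with parameter $\varrho$ is $C(u,v;\varrho)=\Phi_2(\Phi^{-1}(u),\Phi^{-1}(v);\varrho)$, and its density is $$c(u,v;\varrho)=\frac{\partial^2}{\partial u\,\partial v}C(u,v;\varrho)=\frac{\varphi_2(\Phi^{-1}(u),\Phi^{-1}(v);\varrho)}{\varphi(\Phi^{-1}(u))\,\varphi(\Phi^{-1}(v))}.$$ *)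

theory Defs
  imports "HOL-Probability.Probability"
begin

definition std_normal_cdf :: "real \<Rightarrow> real" where
  "std_normal_cdf h = (LBINT x:{..h}. std_normal_density x)"

(* std_normal_cdf is strictly increasing with range (0,1): the inverse is only meaningful there. *)
definition std_normal_quantile :: "real \<Rightarrow> real" where
  "std_normal_quantile = inv std_normal_cdf"

(* The correlation, written last in all functions below, is meant to lie in (-1,1). *)
definition binormal_density :: "real \<Rightarrow> real \<Rightarrow> real \<Rightarrow> real" where
  "binormal_density x y r =
     1 / (2 * pi * sqrt (1 - r\<^sup>2)) * exp (- ((x\<^sup>2 - 2 * r * x * y + y\<^sup>2) / (2 * (1 - r\<^sup>2))))"

definition binormal_cdf :: "real \<Rightarrow> real \<Rightarrow> real \<Rightarrow> real" where
  "binormal_cdf h k r = (LBINT x:{..h}. LBINT y:{..k}. binormal_density x y r)"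

definition binormal_copula :: "real \<Rightarrow> real \<Rightarrow> real \<Rightarrow> real" where
  "binormal_copula u v r = binormal_cdf (std_normal_quantile u) (std_normal_quantile v) r"

(* The mixed partial derivative of the copula; meaningful for u, v in (0,1). *)
definition binormal_copula_density :: "real \<Rightarrow> real \<Rightarrow> real \<Rightarrow> real" where
  "binormal_copula_density u v r = deriv (\<lambda>a. deriv (\<lambda>b. binormal_copula a b r) v) u"

end

(* Bayes' rule for a Gaussian prior N(\<mu>,\<sigma>) on y and a Gaussian kernel N(\<beta>y,\<tau>) from y to w factors the
   joint density the other way round, with w ~ N(\<beta>\<mu>,s), s^2 = \<tau>^2 + \<beta>^2 \<sigma>^2, and a Gaussian posterior of y.
   With Fubini this gives one exchange lemma. It integrates out y in the first double integral, where
   \<beta> and \<gamma> merge into \<beta>\<gamma>, then x, where \<alpha> and \<beta>\<gamma> merge into \<rho>; it also gives the symmetry of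
   the bivariate distribution function, so that the partial derivatives of the copula can be read off
   from the outer integral. The integrals over the unit interval arise by substituting x = \<Phi>^{-1}(s),
   y = \<Phi>^{-1}(t). *)
theory Submission
  imports Defs
begin

section \<open>Univariate Gaussian densities: standardisation, Bayes' rule, exchange of
  integrals\<close>

lemma set_lebesgue_integral_normal_density_atMost:
  assumes "\<sigma> > 0"
  shows "(LBINT w:{..k}. normal_density \<mu> \<sigma> w) = std_normal_cdf ((k - \<mu>) / \<sigma>)"
proof -
  have ind: "indicator {..k} (\<mu> + \<sigma> * x) = (indicator {..(k - \<mu>) / \<sigma>} x :: real)" for x
    using assms by (auto simp: indicator_def field_simps)
  have den: "\<sigma> * normal_density \<mu> \<sigma> (\<mu> + \<sigma> * x) = std_normal_density x" for x
    using assms by (simp add: normal_density_def real_sqrt_mult power_mult_distrib)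
  have "(LBINT w:{..k}. normal_density \<mu> \<sigma> w)
      = (LBINT x. \<sigma> * (indicator {..k} (\<mu> + \<sigma> * x) * normal_density \<mu> \<sigma> (\<mu> + \<sigma> * x)))"
    unfolding set_lebesgue_integral_def
    using lborel_integral_real_affine[of \<sigma> "\<lambda>w. indicator {..k} w *\<^sub>R normal_density \<mu> \<sigma> w" \<mu>] assms
    by simp
  also have "\<dots> = (LBINT x. indicator {..(k - \<mu>) / \<sigma>} x * std_normal_density x)"
    by (intro Bochner_Integration.integral_cong refl) (simp add: ind flip: den)
  finally show ?thesis
    by (simp add: std_normal_cdf_def set_lebesgue_integral_def)
qed

text \<open>Complete the square in \<open>y\<close>. The posterior variance
  \<open>\<tau>\<^sup>2 * \<sigma>\<^sup>2 / s\<^sup>2\<close> is the reciprocal of the total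
  precision \<open>1 / \<sigma>\<^sup>2 + \<beta>\<^sup>2 / \<tau>\<^sup>2\<close>, and the
  normalising constants agree because the two standard deviations on either side have the same
  product.\<close>

lemma normal_density_bayes:
  fixes \<mu> \<sigma> \<tau> \<beta> y w :: real
  assumes "\<sigma> > 0" "\<tau> > 0"
  defines "s \<equiv> sqrt (\<tau>\<^sup>2 + \<beta>\<^sup>2 * \<sigma>\<^sup>2)"
  shows "normal_density \<mu> \<sigma> y * normal_density (\<beta> * y) \<tau> w =
    normal_density (\<beta> * \<mu>) s w *
    normal_density ((\<mu> * \<tau>\<^sup>2 + \<beta> * \<sigma>\<^sup>2 * w) / s\<^sup>2) (\<tau> * \<sigma> / s) y"
proof -
  have S: "s\<^sup>2 = \<tau>\<^sup>2 + \<beta>\<^sup>2 * \<sigma>\<^sup>2" "s > 0"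
    using assms by (auto simp: s_def intro!: add_pos_nonneg)
  define m where "m = (\<mu> * \<tau>\<^sup>2 + \<beta> * \<sigma>\<^sup>2 * w) / s\<^sup>2"
  have m: "m * s\<^sup>2 = \<mu> * \<tau>\<^sup>2 + \<beta> * \<sigma>\<^sup>2 * w"
    using S(2) by (simp add: m_def)
  have "(y - \<mu>)\<^sup>2 / \<sigma>\<^sup>2 + (w - \<beta> * y)\<^sup>2 / \<tau>\<^sup>2 = (w - \<beta> * \<mu>)\<^sup>2 / s\<^sup>2 + (y - m)\<^sup>2 / (\<tau> * \<sigma> / s)\<^sup>2"
  proof -
    \<comment> \<open>The exponent identity multiplied by
      \<open>\<sigma>\<^sup>2 * \<tau>\<^sup>2 * s\<^sup>2\<close>. Keeping the posterior mean in
      the form \<open>m * s\<^sup>2\<close> makes both sides polynomial.\<close>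
    have "((y - \<mu>)\<^sup>2 * \<tau>\<^sup>2 + (w - \<beta> * y)\<^sup>2 * \<sigma>\<^sup>2) * s\<^sup>2 =
        (w - \<beta> * \<mu>)\<^sup>2 * (\<tau>\<^sup>2 * \<sigma>\<^sup>2) + (y * s\<^sup>2 - m * s\<^sup>2)\<^sup>2"
      unfolding m unfolding S(1) by algebra
    then have "((y - \<mu>)\<^sup>2 * \<tau>\<^sup>2 + (w - \<beta> * y)\<^sup>2 * \<sigma>\<^sup>2) * s\<^sup>2 =
        (w - \<beta> * \<mu>)\<^sup>2 * (\<tau>\<^sup>2 * \<sigma>\<^sup>2) + (y - m)\<^sup>2 * s\<^sup>2 * s\<^sup>2"
      by algebra
    \<comment> \<open>Division back to the original form, with \<open>\<sigma>\<^sup>2\<close>,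
      \<open>\<tau>\<^sup>2\<close>, \<open>s\<^sup>2\<close> as atoms \<open>a\<close>,
      \<open>b\<close>, \<open>c\<close> and the squared deviations as \<open>P\<close>,
      \<open>Q\<close>, \<open>R\<close>, \<open>T\<close>, so that only positivity matters.\<close>
    moreover have "P / a + Q / b = R / c + T / (b * a / c)"
      if "(P * b + Q * a) * c = R * (b * a) + T * c * c" "a > 0" "b > 0" "c > 0"
      for P Q R T a b c :: real
    proof -
      have "P / a + Q / b = ((P * b + Q * a) * c) / (a * b * c)"
        using that(2-) by (simp add: field_simps)
      also have "\<dots> = R / c + T / (b * a / c)"
        unfolding that(1) using that(2-) by (simp add: field_simps)
      finally show ?thesis .
    qed
    ultimately show ?thesis
      using assms(1,2) S(2) by (simp add: power_mult_distrib power_divide)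
  qed
  moreover have half: "- a / (2 * b) = - (a / b) / 2" for a b :: real
    by simp
  ultimately have ex: "exp (- (y - \<mu>)\<^sup>2 / (2 * \<sigma>\<^sup>2)) * exp (- (w - \<beta> * y)\<^sup>2 / (2 * \<tau>\<^sup>2)) =
      exp (- (w - \<beta> * \<mu>)\<^sup>2 / (2 * s\<^sup>2)) * exp (- (y - m)\<^sup>2 / (2 * (\<tau> * \<sigma> / s)\<^sup>2))"
    unfolding exp_add[symmetric] half by (simp only: add_divide_distrib[symmetric] minus_add_distrib[symmetric])
  have sq: "sqrt (2 * pi * a\<^sup>2) = sqrt (2 * pi) * a" if "a > 0" for a :: real
    using that by (simp add: real_sqrt_mult)
  have const: "1 / sqrt (2 * pi * \<sigma>\<^sup>2) * (1 / sqrt (2 * pi * \<tau>\<^sup>2)) =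
      1 / sqrt (2 * pi * s\<^sup>2) * (1 / sqrt (2 * pi * (\<tau> * \<sigma> / s)\<^sup>2))"
  proof -
    have "\<tau> * \<sigma> / s > 0"
      using assms(1,2) S(2) by simp
    then show ?thesis
      unfolding sq[OF assms(1)] sq[OF assms(2)] sq[OF S(2)] sq[OF \<open>\<tau> * \<sigma> / s > 0\<close>]
      using S(2) by (simp only: times_divide_times_eq mult_1) (simp add: mult_ac)
  qed
  have shuffle: "a * e * (b * f) = a * b * (e * f)" for a b e f :: real
    by simp
  show ?thesis
    unfolding normal_density_def m_def[symmetric] shuffle const ex ..
qed

text \<open>Fubini for the joint density times \<open>G y * indicator A w\<close>, then Bayes' rule
  in the inner integral. The bounded weight \<open>G\<close> is left general because it will be the
  constant 1, an indicator, or a normal distribution function; its bound lets the joint density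
  dominate the integrand.\<close>

lemma integral_normal_density_kernel_swap:
  fixes G :: "real \<Rightarrow> real" and \<mu> \<sigma> \<tau> \<beta> :: real
  assumes "\<sigma> > 0" "\<tau> > 0"
    and [measurable]: "G \<in> borel_measurable borel" "A \<in> sets borel"
    and G: "\<And>y. \<bar>G y\<bar> \<le> 1"
  defines "s \<equiv> sqrt (\<tau>\<^sup>2 + \<beta>\<^sup>2 * \<sigma>\<^sup>2)"
  shows "(LBINT y. normal_density \<mu> \<sigma> y * G y * (LBINT w:A. normal_density (\<beta> * y) \<tau> w)) =
    (LBINT w:A. normal_density (\<beta> * \<mu>) s w *
      (LBINT y. normal_density ((\<mu> * \<tau>\<^sup>2 + \<beta> * \<sigma>\<^sup>2 * w) / s\<^sup>2) (\<tau> * \<sigma> / s) y * G y))"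
    (is "?L = ?R")
proof -
  have [measurable]: "normal_density a b \<in> borel_measurable borel" for a b by simp
  have [measurable]: "(\<lambda>p. normal_density (\<beta> * fst p) \<tau> (snd p)) \<in> borel_measurable (lborel \<Otimes>\<^sub>M lborel)"
    unfolding normal_density_def by measurable
  let ?k = "\<lambda>(y, w). normal_density \<mu> \<sigma> y * normal_density (\<beta> * y) \<tau> w"
  let ?f = "\<lambda>(y, w). normal_density \<mu> \<sigma> y * normal_density (\<beta> * y) \<tau> w * (G y * indicator A w)"
  \<comment> \<open>For each \<open>y\<close> the kernel integrates to 1 over \<open>w\<close>, so
    the inner integral of the norm is just the prior density.\<close>
  have "integrable (lborel \<Otimes>\<^sub>M lborel) ?k"
  proof (rule lborel_pair.Fubini_integrable)
    show "?k \<in> borel_measurable (lborel \<Otimes>\<^sub>M lborel)"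
      by (simp add: split_beta')
  qed (use assms(1,2) in \<open>auto simp: integral_normal_density\<close>)
  then have int: "integrable (lborel \<Otimes>\<^sub>M lborel) ?f"
  proof (rule Bochner_Integration.integrable_bound)
    show "?f \<in> borel_measurable (lborel \<Otimes>\<^sub>M lborel)"
      by (simp add: split_beta')
    have bound: "\<bar>a * (G y * indicator A w)\<bar> \<le> \<bar>a\<bar>" for a y w
      using G[of y] by (auto simp: indicator_def abs_mult intro: mult_left_le)
    show "AE x in lborel \<Otimes>\<^sub>M lborel. norm (?f x) \<le> norm (?k x)"
      by (intro AE_I2) (simp only: split_beta' real_norm_def bound)
  qed
  have "normal_density \<mu> \<sigma> y * G y * (LBINT w:A. normal_density (\<beta> * y) \<tau> w) =
      (LBINT w. ?f (y, w))" for y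
    unfolding set_lebesgue_integral_def
    by (subst integral_mult_right_zero[symmetric])
      (rule Bochner_Integration.integral_cong, simp_all add: ac_simps)
  then have "?L = (LBINT y. LBINT w. ?f (y, w))"
    by simp
  also have "\<dots> = (LBINT w. LBINT y. ?f (y, w))"
    using lborel_pair.Fubini_integral[OF int] by simp
  also have "(\<lambda>w. LBINT y. ?f (y, w)) = (\<lambda>w. indicator A w *\<^sub>R (normal_density (\<beta> * \<mu>) s w *
      (LBINT y. normal_density ((\<mu> * \<tau>\<^sup>2 + \<beta> * \<sigma>\<^sup>2 * w) / s\<^sup>2) (\<tau> * \<sigma> / s) y * G y)))"
  proof
    fix w
    have "(LBINT y. ?f (y, w)) = (LBINT y. indicator A w * normal_density (\<beta> * \<mu>) s w *
        (normal_density ((\<mu> * \<tau>\<^sup>2 + \<beta> * \<sigma>\<^sup>2 * w) / s\<^sup>2) (\<tau> * \<sigma> / s) y * G y))"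
      unfolding prod.case normal_density_bayes[OF assms(1,2)] s_def
      by (simp only: ac_simps)
    then show "(LBINT y. ?f (y, w)) = indicator A w *\<^sub>R (normal_density (\<beta> * \<mu>) s w *
        (LBINT y. normal_density ((\<mu> * \<tau>\<^sup>2 + \<beta> * \<sigma>\<^sup>2 * w) / s\<^sup>2) (\<tau> * \<sigma> / s) y * G y))"
      by (simp add: mult.assoc)
  qed
  finally show ?thesis
    by (simp only: set_lebesgue_integral_def)
qed

section \<open>Symmetry and factorisation of the bivariate density\<close>

lemma binormal_density_commute: "binormal_density x y r = binormal_density y x r"
proof -
  have "x\<^sup>2 - 2 * r * x * y + y\<^sup>2 = y\<^sup>2 - 2 * r * y * x + x\<^sup>2"
    by (simp add: algebra_simps)
  then show ?thesis
    by (simp only: binormal_density_def)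
qed

text \<open>Completing the square in \<open>y\<close> exhibits the marginal of \<open>x\<close> and
  the conditional law of \<open>y\<close> given \<open>x\<close>. In this form a bivariate integral
  is a Gaussian prior followed by a Gaussian kernel.\<close>

lemma binormal_density_conv_normal_density:
  assumes "r \<in> {-1<..<1}"
  shows "binormal_density x y r = std_normal_density x * normal_density (r * x) (sqrt (1 - r\<^sup>2)) y"
proof -
  have r: "1 - r\<^sup>2 > 0"
    using assms by (simp add: abs_square_less_1 abs_less_iff)
  have "- ((x\<^sup>2 - 2 * r * x * y + y\<^sup>2) / (2 * (1 - r\<^sup>2))) =
      - x\<^sup>2 / 2 + - (y - r * x)\<^sup>2 / (2 * (1 - r\<^sup>2))"
    using r by (simp add: divide_simps) algebra
  then have ex: "exp (- ((x\<^sup>2 - 2 * r * x * y + y\<^sup>2) / (2 * (1 - r\<^sup>2)))) =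
      exp (- x\<^sup>2 / 2) * exp (- (y - r * x)\<^sup>2 / (2 * (1 - r\<^sup>2)))"
    by (simp only: exp_add)
  have "sqrt (2 * pi) * sqrt (2 * pi * (1 - r\<^sup>2)) = sqrt ((2 * pi)\<^sup>2 * (1 - r\<^sup>2))"
    by (simp only: real_sqrt_mult[symmetric]) (simp add: power2_eq_square algebra_simps)
  also have "\<dots> = 2 * pi * sqrt (1 - r\<^sup>2)"
    by (simp add: real_sqrt_mult)
  finally show ?thesis
    using r unfolding binormal_density_def normal_density_def ex by simp
qed

section \<open>The standard normal distribution function, its inverse, and the substitution between
  them\<close>

lemma has_real_derivative_set_integral_atMost:
  fixes f :: "real \<Rightarrow> real"
  assumes cont: "continuous_on UNIV f" and int: "integrable lborel f"
  shows "((\<lambda>k. LBINT y:{..k}. f y) has_real_derivative f k) (at k)"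
proof -
  \<comment> \<open>Any point below \<open>k\<close> would do: the tail up to \<open>a\<close>
    contributes a constant, and the fundamental theorem of calculus applies on a compact interval
    with \<open>k\<close> in its interior.\<close>
  define a where "a = k - 1"
  have si: "set_integrable lborel S f" if "S \<in> sets borel" for S
    using integrable_mult_indicator[of S lborel f] that int by (simp add: set_integrable_def)
  have eq: "(LBINT y:{..a}. f y) + integral {a..x} f = (LBINT y:{..x}. f y)" if "x \<in> {a<..}" for x
  proof -
    have "{..a} \<union> {a..x} = {..x}" "{..a} \<inter> {a..x} = {a}"
      using that by auto
    then have "integral {..x} f = integral {..a} f + integral {a..x} f"
      using integral_Un[of f "{..a}" "{a..x}"] set_borel_integral_eq_integral(1)[OF si] by auto
    then show ?thesis
      by (simp add: set_borel_integral_eq_integral(2)[OF si])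
  qed
  have "((\<lambda>x. integral {a..x} f) has_real_derivative f k) (at k within {a..k+1})"
    by (rule integral_has_real_derivative)
      (auto simp: a_def intro: continuous_on_subset[OF cont])
  then have "((\<lambda>x. integral {a..x} f) has_real_derivative f k) (at k)"
    by (subst (asm) at_within_Icc_at) (auto simp: a_def)
  then have "((\<lambda>x. (LBINT y:{..a}. f y) + integral {a..x} f) has_real_derivative f k) (at k)"
    by (auto intro!: derivative_eq_intros)
  then show ?thesis
    by (rule has_field_derivative_transform_within_open[where S="{a<..}"])
      (auto simp: a_def intro!: eq[unfolded a_def])
qed

lemma DERIV_std_normal_cdf:
  "(std_normal_cdf has_real_derivative std_normal_density h) (at h)"
proof -
  have "continuous_on UNIV (normal_density 0 1)"
    unfolding normal_density_def by (intro continuous_intros) auto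
  then show ?thesis
    using has_real_derivative_set_integral_atMost[of std_normal_density h]
    by (simp add: std_normal_cdf_def[abs_def])
qed

lemma DERIV_std_normal_cdf_comp [derivative_intros]:
  "(f has_real_derivative d) (at x within S) \<Longrightarrow>
    ((\<lambda>x. std_normal_cdf (f x)) has_real_derivative std_normal_density (f x) * d) (at x within S)"
  by (rule DERIV_chain2[OF DERIV_std_normal_cdf])

lemma continuous_on_std_normal_cdf [continuous_intros]:
  "continuous_on S f \<Longrightarrow> continuous_on S (\<lambda>x. std_normal_cdf (f x))"
  by (rule continuous_on_compose2[of UNIV std_normal_cdf])
    (auto intro: DERIV_continuous_on[OF DERIV_std_normal_cdf])

lemma borel_measurable_std_normal_cdf [measurable]: "std_normal_cdf \<in> borel_measurable borel"
  by (intro borel_measurable_continuous_onI continuous_intros)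

lemma strict_mono_std_normal_cdf: "strict_mono std_normal_cdf"
proof (rule strict_monoI)
  fix x y :: real
  assume "x < y"
  then show "std_normal_cdf x < std_normal_cdf y"
  proof (rule DERIV_pos_imp_increasing)
    show "\<exists>d. DERIV std_normal_cdf z :> d \<and> 0 < d" for z
      by (rule exI, rule conjI, rule DERIV_std_normal_cdf, rule normal_density_pos) simp
  qed
qed

text \<open>Viewing the integral as the distribution function of a probability measure gives its
  limits at both infinities and the bounds 0 and 1.\<close>

lemma std_normal_cdf_eq_cdf:
  "std_normal_cdf = cdf (density lborel std_normal_density)"
proof
  fix h
  have si: "set_integrable lborel {..h} std_normal_density"
    using integrable_mult_indicator[of "{..h}" lborel std_normal_density]
    by (simp add: set_integrable_def)
  have "emeasure (density lborel std_normal_density) {..h} =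
      (\<integral>\<^sup>+x. ennreal (indicator {..h} x * std_normal_density x) \<partial>lborel)"
    by (auto simp: emeasure_density ennreal_mult'' intro!: nn_integral_cong split: split_indicator)
  also have "\<dots> = ennreal (std_normal_cdf h)"
    using si by (subst nn_integral_eq_integral)
      (auto simp: set_integrable_def std_normal_cdf_def set_lebesgue_integral_def)
  finally show "std_normal_cdf h = cdf (density lborel std_normal_density) h"
    by (simp add: cdf_def measure_def std_normal_cdf_def set_lebesgue_integral_def)
qed

lemma range_std_normal_cdf: "range std_normal_cdf = {0<..<1}"
proof -
  interpret real_distribution "density lborel std_normal_density"
    by (intro real_distribution.intro prob_space_normal_density real_distribution_axioms.intro) auto
  have top: "(std_normal_cdf \<longlongrightarrow> 1) at_top" and bot: "(std_normal_cdf \<longlongrightarrow> 0) at_bot"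
    unfolding std_normal_cdf_eq_cdf by (rule cdf_lim_at_top_prob cdf_lim_at_bot)+
  have le: "0 \<le> std_normal_cdf x" "std_normal_cdf x \<le> 1" for x
    unfolding std_normal_cdf_eq_cdf by (rule cdf_nonneg cdf_bounded_prob)+
  have lt: "std_normal_cdf x < std_normal_cdf y" if "x < y" for x y
    using strict_mono_std_normal_cdf that by (rule strict_monoD)
  show ?thesis
  proof (intro equalityI subsetI)
    fix p assume "p \<in> range std_normal_cdf"
    then obtain x where "p = std_normal_cdf x" by auto
    \<comment> \<open>The known bounds are weak; comparison with the values at \<open>x - 1\<close>
      and \<open>x + 1\<close> makes them strict.\<close>
    with lt[of x "x + 1"] lt[of "x - 1" x] le(2)[of "x + 1"] le(1)[of "x - 1"]
    show "p \<in> {0<..<1}" by auto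
  next
    fix p :: real assume p: "p \<in> {0<..<1}"
    then obtain a where a: "std_normal_cdf a < p"
      using order_tendstoD(2)[OF bot, of p] by (auto simp: eventually_at_bot_linorder)
    from p obtain b where b: "p < std_normal_cdf b"
      using order_tendstoD(1)[OF top, of p] by (auto simp: eventually_at_top_linorder)
    have "a \<le> b"
      using a b lt[of b a] by linarith
    with a b IVT'[of std_normal_cdf a p b] continuous_on_std_normal_cdf[OF continuous_on_id]
    show "p \<in> range std_normal_cdf"
      by auto
  qed
qed

lemma std_normal_cdf_bounds: "0 < std_normal_cdf x" "std_normal_cdf x < 1"
  using range_std_normal_cdf by auto

lemma std_normal_quantile_cdf [simp]: "std_normal_quantile (std_normal_cdf x) = x"
  unfolding std_normal_quantile_def
  by (rule inv_f_f[OF strict_mono_imp_inj_on[OF strict_mono_std_normal_cdf]])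

lemma std_normal_cdf_quantile: "p \<in> {0<..<1} \<Longrightarrow> std_normal_cdf (std_normal_quantile p) = p"
  unfolding std_normal_quantile_def by (rule f_inv_into_f) (simp add: range_std_normal_cdf)

lemma DERIV_std_normal_quantile:
  assumes "p \<in> {0<..<1}"
  shows "(std_normal_quantile has_real_derivative
    1 / std_normal_density (std_normal_quantile p)) (at p)"
proof -
  have "isCont std_normal_cdf x" for x
    using DERIV_std_normal_cdf by (rule DERIV_isCont)
  \<comment> \<open>The inverse function rule needs continuity of the inverse at \<open>p\<close>.
    The left inverse identity holds on the whole line, so the radius 1 of the neighbourhood is
    arbitrary.\<close>
  then have "isCont std_normal_quantile (std_normal_cdf (std_normal_quantile p))"
    by (rule isCont_inverse_function[of 1, rotated 2]) simp_all
  then have cont: "isCont std_normal_quantile p"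
    by (simp add: std_normal_cdf_quantile[OF assms])
  have "DERIV std_normal_quantile p :> inverse (std_normal_density (std_normal_quantile p))"
  proof (rule DERIV_inverse_function[OF DERIV_std_normal_cdf _ _ _ _ cont])
    show "std_normal_density (std_normal_quantile p) \<noteq> 0"
      using normal_density_pos[of 1 0 "std_normal_quantile p"] by simp
    show "0 < p" "p < 1"
      using assms by auto
  qed (rule std_normal_cdf_quantile, simp)
  then show ?thesis
    by (simp only: inverse_eq_divide)
qed

text \<open>Substitute \<open>p = std_normal_cdf x\<close>, a bijection of the line onto the open
  unit interval with derivative \<open>std_normal_density x\<close>.\<close>

lemma set_integral_std_normal_quantile:
  fixes F :: "real \<Rightarrow> real"
  assumes [measurable]: "F \<in> borel_measurable borel"
    and int: "integrable lborel (\<lambda>x. std_normal_density x * F x)"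
  shows "(LBINT p:{0<..<1}. F (std_normal_quantile p)) = (LBINT x. std_normal_density x * F x)"
proof -
  let ?G = "\<lambda>p. F (std_normal_quantile p)"
  have "continuous_on {0<..<1} std_normal_quantile"
    by (rule DERIV_continuous_on, rule has_field_derivative_at_within,
        rule DERIV_std_normal_quantile)
  \<comment> \<open>Continuity of the quantile is known only inside the unit interval, so
    measurability is shown for its truncation; the outer indicator hides the difference.\<close>
  then have [measurable]: "(\<lambda>p. indicator {0<..<1} p *\<^sub>R std_normal_quantile p) \<in> borel_measurable borel"
    by (intro borel_measurable_continuous_on_indicator) auto
  have "(\<lambda>p. indicator {0<..<1} p *\<^sub>R ?G p) =
      (\<lambda>p. indicator {0<..<1} p *\<^sub>R F (indicator {0<..<1} p *\<^sub>R std_normal_quantile p))"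
    by (auto simp: indicator_def)
  moreover have "\<dots> \<in> borel_measurable lborel"
    by measurable
  ultimately have meas: "(\<lambda>p. indicator {0<..<1} p *\<^sub>R ?G p) \<in> borel_measurable lborel"
    by simp
  have int_UNIV: "set_integrable lborel UNIV (\<lambda>x. std_normal_density x * F x)"
    using int by (simp add: set_integrable_def)
  have "(\<lambda>x. \<bar>std_normal_density x\<bar> * ?G (std_normal_cdf x)) absolutely_integrable_on UNIV"
    using int by (simp add: set_integrable_def integrable_completion)
  moreover have "integral UNIV (\<lambda>x. \<bar>std_normal_density x\<bar> * ?G (std_normal_cdf x)) =
      (LBINT x. std_normal_density x * F x)"
    using set_borel_integral_eq_integral(2)[OF int_UNIV]
    by (simp add: set_lebesgue_integral_def)
  ultimately have G: "?G absolutely_integrable_on {0<..<1}"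
    and b: "integral {0<..<1} ?G = (LBINT x. std_normal_density x * F x)"
    using has_absolute_integral_change_of_variables_1'[of UNIV std_normal_cdf std_normal_density ?G]
      DERIV_std_normal_cdf strict_mono_imp_inj_on[OF strict_mono_std_normal_cdf]
    by (auto simp: range_std_normal_cdf)
  \<comment> \<open>The substitution rule speaks of the completed Lebesgue measure; Borel
    measurability of the integrand carries the value back to \<open>lborel\<close>.\<close>
  have "(LBINT p:{0<..<1}. ?G p) = (LINT p:{0<..<1}|lebesgue. ?G p)"
    unfolding set_lebesgue_integral_def by (rule integral_completion[OF meas, symmetric])
  also have "\<dots> = integral {0<..<1} ?G"
    by (rule set_lebesgue_integral_eq_integral(2)[OF G])
  finally show ?thesis
    by (simp only: b)
qed

section \<open>Consequences of the exchange lemma for distribution functions\<close>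

lemma integral_normal_density_std_normal_cdf:
  fixes \<mu> \<sigma> \<tau> \<beta> k :: real
  assumes "\<sigma> > 0" "\<tau> > 0"
  shows "(LBINT y. normal_density \<mu> \<sigma> y * std_normal_cdf ((k - \<beta> * y) / \<tau>)) =
    std_normal_cdf ((k - \<beta> * \<mu>) / sqrt (\<tau>\<^sup>2 + \<beta>\<^sup>2 * \<sigma>\<^sup>2))"
proof -
  have pos: "sqrt (\<tau>\<^sup>2 + \<beta>\<^sup>2 * \<sigma>\<^sup>2) > 0"
    using assms by (auto intro!: add_pos_nonneg)
  then have "\<tau> * \<sigma> / sqrt (\<tau>\<^sup>2 + \<beta>\<^sup>2 * \<sigma>\<^sup>2) > 0"
    using assms by simp
  \<comment> \<open>With weight 1 the posterior integrates to 1, and what remains is the marginal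
    law of \<open>w\<close> on \<open>{..k}\<close>.\<close>
  then show ?thesis
    using integral_normal_density_kernel_swap[of \<sigma> \<tau> "\<lambda>_. 1" "{..k}" \<mu> \<beta>] assms pos
    by (simp add: set_lebesgue_integral_normal_density_atMost)
qed

lemma sqrt_one_minus_square_pos: "r \<in> {-1<..<1} \<Longrightarrow> 0 < sqrt (1 - r\<^sup>2)" for r :: real
  by (simp add: abs_square_less_1 abs_less_iff)

lemma sqrt_one_minus_square_power2: "r \<in> {-1<..<1} \<Longrightarrow> (sqrt (1 - r\<^sup>2))\<^sup>2 = 1 - r\<^sup>2" for r :: real
  using sqrt_one_minus_square_pos[of r] by simp

lemma binormal_cdf_eq_set_integral:
  assumes "r \<in> {-1<..<1}"
  shows "binormal_cdf h k r =
    (LBINT x:{..h}. std_normal_density x * std_normal_cdf ((k - r * x) / sqrt (1 - r\<^sup>2)))"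
  using sqrt_one_minus_square_pos[OF assms]
  by (simp add: binormal_cdf_def binormal_density_conv_normal_density[OF assms]
      set_lebesgue_integral_normal_density_atMost)

text \<open>For a standard normal prior and \<open>\<tau>\<^sup>2 = 1 - r\<^sup>2\<close> one has
  \<open>s = 1\<close>: the marginal of \<open>w\<close> is again standard normal and the posterior
  is the same kernel reversed.\<close>

lemma integral_std_normal_density_kernel_swap:
  fixes G :: "real \<Rightarrow> real"
  assumes r: "r \<in> {-1<..<1}" and G: "G \<in> borel_measurable borel" "\<And>y. \<bar>G y\<bar> \<le> 1"
  shows "(LBINT y. std_normal_density y * G y * std_normal_cdf ((k - r * y) / sqrt (1 - r\<^sup>2))) =
    (LBINT w:{..k}. std_normal_density w * (LBINT y. normal_density (r * w) (sqrt (1 - r\<^sup>2)) y * G y))"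
  using integral_normal_density_kernel_swap[of 1 "sqrt (1 - r\<^sup>2)" G "{..k}" 0 r]
    sqrt_one_minus_square_pos[OF r] G
  by (simp add: set_lebesgue_integral_normal_density_atMost sqrt_one_minus_square_power2[OF r]
      del: real_sqrt_gt_0_iff)

text \<open>Take the indicator of \<open>{..h}\<close> as the weight in the exchange; each side is
  then the one-dimensional form of one of the two distribution functions.\<close>

lemma binormal_cdf_commute:
  assumes "r \<in> {-1<..<1}"
  shows "binormal_cdf h k r = binormal_cdf k h r"
proof -
  have "(LBINT y. std_normal_density y * indicator {..h} y * std_normal_cdf ((k - r * y) / sqrt (1 - r\<^sup>2))) =
      (LBINT w:{..k}. std_normal_density w *
        (LBINT y. normal_density (r * w) (sqrt (1 - r\<^sup>2)) y * indicator {..h} y))"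
    by (rule integral_std_normal_density_kernel_swap[OF assms]) (auto simp: indicator_def)
  then show ?thesis
    using set_lebesgue_integral_normal_density_atMost[OF sqrt_one_minus_square_pos[OF assms], of h "r * w" for w]
    by (simp add: binormal_cdf_eq_set_integral[OF assms] set_lebesgue_integral_def ac_simps)
qed

section \<open>Partial derivatives and density of the copula\<close>

lemma DERIV_binormal_cdf:
  assumes r: "r \<in> {-1<..<1}"
  shows "((\<lambda>k. binormal_cdf h k r) has_real_derivative
    std_normal_density k * std_normal_cdf ((h - r * k) / sqrt (1 - r\<^sup>2))) (at k)"
proof -
  let ?f = "\<lambda>y. std_normal_density y * std_normal_cdf ((h - r * y) / sqrt (1 - r\<^sup>2))"
  have "continuous_on UNIV ?f"
    using sqrt_one_minus_square_pos[OF r]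
    unfolding normal_density_def by (intro continuous_intros) auto
  moreover have "integrable lborel ?f"
  proof (rule Bochner_Integration.integrable_bound)
    show "integrable lborel std_normal_density" by simp
    show "AE y in lborel. norm (?f y) \<le> norm (std_normal_density y)"
      using std_normal_cdf_bounds by (intro AE_I2) (simp add: abs_mult mult_left_le less_imp_le)
  qed measurable
  ultimately have "((\<lambda>k. LBINT y:{..k}. ?f y) has_real_derivative ?f k) (at k)"
    by (rule has_real_derivative_set_integral_atMost)
  \<comment> \<open>Symmetry turns \<open>k\<close> into the limit of the outer integral, where the
    fundamental theorem of calculus reaches it.\<close>
  moreover have "binormal_cdf h k r = (LBINT y:{..k}. ?f y)" for k
    unfolding binormal_cdf_commute[OF r, of h k] by (rule binormal_cdf_eq_set_integral[OF r])
  ultimately show ?thesis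
    by simp
qed

text \<open>In the chain rule the density factor cancels against the derivative of the quantile.
  Leaving \<open>a\<close> arbitrary lets the identity rewrite inside the outer derivative of
  \<open>binormal_copula_density\<close>.\<close>

lemma deriv_binormal_copula:
  assumes r: "r \<in> {-1<..<1}" and t: "t \<in> {0<..<1}"
  shows "deriv (\<lambda>b. binormal_copula a b r) t =
    std_normal_cdf ((std_normal_quantile a - r * std_normal_quantile t) / sqrt (1 - r\<^sup>2))"
proof -
  have "std_normal_density (std_normal_quantile t) \<noteq> 0"
    using normal_density_pos[of 1 0] by (metis less_irrefl zero_less_one)
  with DERIV_chain2[OF DERIV_binormal_cdf[OF r] DERIV_std_normal_quantile[OF t],
      of "std_normal_quantile a"]
  show ?thesis
    by (intro DERIV_imp_deriv) (simp add: binormal_copula_def)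
qed

lemma binormal_copula_commute: "r \<in> {-1<..<1} \<Longrightarrow> binormal_copula a b r = binormal_copula b a r"
  by (simp only: binormal_copula_def binormal_cdf_commute)

lemma normal_density_conv_std_normal_density:
  "\<sigma> > 0 \<Longrightarrow> normal_density \<mu> \<sigma> x = std_normal_density ((x - \<mu>) / \<sigma>) / \<sigma>"
  by (simp add: normal_density_def real_sqrt_mult power_divide)

text \<open>Differentiating the conditional distribution function in \<open>a\<close> gives the
  conditional density of \<open>x\<close> given \<open>y\<close>, divided by the density of
  \<open>x\<close>. Conditioning is on the second coordinate, hence the swap of arguments before
  factorising.\<close>

lemma binormal_copula_density_eq:
  assumes r: "r \<in> {-1<..<1}" and s: "s \<in> {0<..<1}" and t: "t \<in> {0<..<1}"
  shows "binormal_copula_density s t r =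
    binormal_density (std_normal_quantile s) (std_normal_quantile t) r /
    (std_normal_density (std_normal_quantile s) * std_normal_density (std_normal_quantile t))"
proof -
  define x y \<sigma> where "x = std_normal_quantile s" and "y = std_normal_quantile t" and "\<sigma> = sqrt (1 - r\<^sup>2)"
  have \<sigma>: "\<sigma> > 0"
    unfolding \<sigma>_def by (rule sqrt_one_minus_square_pos[OF r])
  have y: "std_normal_density y > 0"
    by (simp add: normal_density_pos)
  have "((\<lambda>a. std_normal_cdf ((std_normal_quantile a - r * y) / \<sigma>)) has_real_derivative
      std_normal_density ((x - r * y) / \<sigma>) * (1 / std_normal_density x / \<sigma>)) (at s)"
    unfolding x_def
    using DERIV_std_normal_quantile[OF s] \<sigma> by (auto intro!: derivative_eq_intros)
  then have "binormal_copula_density s t r = normal_density (r * y) \<sigma> x / std_normal_density x"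
    unfolding binormal_copula_density_def deriv_binormal_copula[OF r t]
      normal_density_conv_std_normal_density[OF \<sigma>]
    by (intro DERIV_imp_deriv) (simp add: y_def \<sigma>_def mult.commute)
  also have "\<dots> = binormal_density x y r / (std_normal_density x * std_normal_density y)"
    using y unfolding binormal_density_commute[of x y]
    unfolding binormal_density_conv_normal_density[OF r] \<sigma>_def by simp
  finally show ?thesis
    by (simp only: x_def y_def)
qed

section \<open>Merging the correlations and the three representations\<close>

lemma integral_std_normal_cdf_binormal_density:
  assumes "\<beta> \<in> {-1<..<1}" "\<gamma> \<in> {-1<..<1}"
  shows "(LBINT y. std_normal_cdf ((k - \<beta> * y) / sqrt (1 - \<beta>\<^sup>2)) * binormal_density x y \<gamma>) =
    std_normal_density x * std_normal_cdf ((k - \<beta> * \<gamma> * x) / sqrt (1 - (\<beta> * \<gamma>)\<^sup>2))"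
proof -
  \<comment> \<open>The kernel's variance plus \<open>\<beta>\<^sup>2\<close> times the conditional
    variance of \<open>y\<close> given \<open>x\<close>.\<close>
  have "1 - \<beta>\<^sup>2 + \<beta>\<^sup>2 * (1 - \<gamma>\<^sup>2) = 1 - (\<beta> * \<gamma>)\<^sup>2"
    by (simp add: algebra_simps)
  then have "(LBINT y. normal_density (\<gamma> * x) (sqrt (1 - \<gamma>\<^sup>2)) y *
      std_normal_cdf ((k - \<beta> * y) / sqrt (1 - \<beta>\<^sup>2))) =
      std_normal_cdf ((k - \<beta> * \<gamma> * x) / sqrt (1 - (\<beta> * \<gamma>)\<^sup>2))"
    using integral_normal_density_std_normal_cdf[OF sqrt_one_minus_square_pos[OF assms(2)]
        sqrt_one_minus_square_pos[OF assms(1)], of "\<gamma> * x" k \<beta>]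
    by (simp only: sqrt_one_minus_square_power2[OF assms(1)]
        sqrt_one_minus_square_power2[OF assms(2)] mult.assoc)
  then show ?thesis
    unfolding binormal_density_conv_normal_density[OF assms(2)]
    by (simp add: mult.assoc mult.left_commute[of "std_normal_cdf _"] mult.commute[of "std_normal_cdf _"])
qed

theorem mainTheorem1:
  fixes \<rho> \<alpha> \<beta> \<gamma> u v :: real
  assumes "\<rho> \<in> {-1<..<1}" and "\<rho> \<noteq> 0"
    and "\<alpha> \<in> {-1<..<1}" and "\<beta> \<in> {-1<..<1}" and "\<gamma> \<in> {-1<..<1}"
    and "\<alpha> * \<beta> * \<gamma> = \<rho>"
    and "u \<in> {0<..<1}" and "v \<in> {0<..<1}"
  shows "binormal_copula u v \<rho> =
      (LBINT x. LBINT y.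
         std_normal_cdf ((std_normal_quantile u - \<alpha> * x) / sqrt (1 - \<alpha>\<^sup>2)) *
         std_normal_cdf ((std_normal_quantile v - \<beta> * y) / sqrt (1 - \<beta>\<^sup>2)) *
         binormal_density x y \<gamma>)
    \<and> binormal_copula u v \<rho> =
      (LBINT s:{0<..<1}. LBINT t:{0<..<1}.
         std_normal_cdf ((std_normal_quantile u - \<alpha> * std_normal_quantile s) / sqrt (1 - \<alpha>\<^sup>2)) *
         std_normal_cdf ((std_normal_quantile v - \<beta> * std_normal_quantile t) / sqrt (1 - \<beta>\<^sup>2)) *
         binormal_copula_density s t \<gamma>)
    \<and> binormal_copula u v \<rho> =
      (LBINT s:{0<..<1}. LBINT t:{0<..<1}.
         deriv (\<lambda>a. binormal_copula u a \<alpha>) s *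
         deriv (\<lambda>b. binormal_copula b v \<beta>) t *
         binormal_copula_density s t \<gamma>)"
proof -
  \<comment> \<open>\<open>\<delta>\<close> is the correlation left after \<open>y\<close> is
    integrated out, and \<open>G\<close> below is the factor that \<open>B\<close> turns
    into.\<close>
  define h k \<delta> where "h = std_normal_quantile u" and "k = std_normal_quantile v" and "\<delta> = \<beta> * \<gamma>"
  define A B where "A x = std_normal_cdf ((h - \<alpha> * x) / sqrt (1 - \<alpha>\<^sup>2))"
    and "B y = std_normal_cdf ((k - \<beta> * y) / sqrt (1 - \<beta>\<^sup>2))" for x y
  define G where "G x = std_normal_cdf ((k - \<delta> * x) / sqrt (1 - \<delta>\<^sup>2))" for x
  have meas [measurable]: "A \<in> borel_measurable borel" "B \<in> borel_measurable borel"
    "G \<in> borel_measurable borel"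
    unfolding A_def B_def G_def by measurable
  have bounds: "\<bar>A x\<bar> \<le> 1" "\<bar>B x\<bar> \<le> 1" "\<bar>G x\<bar> \<le> 1" for x
    unfolding A_def B_def G_def using std_normal_cdf_bounds by (simp_all add: less_imp_le)
  have \<delta>: "\<delta> \<in> {-1<..<1}"
  proof -
    have "\<bar>\<beta> * \<gamma>\<bar> < 1"
      using assms(4,5) abs_mult_less[of \<beta> 1 \<gamma> 1] by (simp add: abs_mult abs_less_iff[of \<beta>] abs_less_iff[of \<gamma>])
    then show ?thesis
      by (auto simp: \<delta>_def abs_less_iff[of "\<beta> * \<gamma>"])
  qed
  have inner: "(LBINT y. B y * binormal_density x y \<gamma>) = std_normal_density x * G x" for x
    unfolding B_def G_def \<delta>_def
    by (rule integral_std_normal_cdf_binormal_density[OF assms(4,5)])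
  have outer: "(LBINT x. std_normal_density x * (A x * G x)) = binormal_cdf h k \<rho>"
  proof -
    \<comment> \<open>The second merge: averaging \<open>G\<close> over the reversed kernel of
      correlation \<open>\<alpha>\<close> combines \<open>\<delta>\<close> and
      \<open>\<alpha>\<close> into \<open>\<rho>\<close>.\<close>
    have smooth: "(LBINT y. normal_density (\<alpha> * w) (sqrt (1 - \<alpha>\<^sup>2)) y * G y) =
        std_normal_cdf ((k - \<rho> * w) / sqrt (1 - \<rho>\<^sup>2))" for w
    proof -
      have "1 - \<delta>\<^sup>2 + \<delta>\<^sup>2 * (1 - \<alpha>\<^sup>2) = 1 - \<rho>\<^sup>2" "\<delta> * (\<alpha> * w) = \<rho> * w"
        unfolding \<delta>_def assms(6)[symmetric] by (simp_all add: algebra_simps)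
      then show ?thesis
        unfolding G_def
        using integral_normal_density_std_normal_cdf[OF sqrt_one_minus_square_pos[OF assms(3)]
          sqrt_one_minus_square_pos[OF \<delta>], of "\<alpha> * w" k \<delta>]
        by (simp only: sqrt_one_minus_square_power2[OF assms(3)] sqrt_one_minus_square_power2[OF \<delta>])
    qed
    \<comment> \<open>In the exchange \<open>A\<close> supplies the kernel and \<open>G\<close> is
      the weight.\<close>
    have "(LBINT x. std_normal_density x * G x * A x) = (LBINT w:{..h}. std_normal_density w *
        (LBINT y. normal_density (\<alpha> * w) (sqrt (1 - \<alpha>\<^sup>2)) y * G y))"
      unfolding A_def by (rule integral_std_normal_density_kernel_swap[OF assms(3) meas(3) bounds(3)])
    also have "\<dots> = binormal_cdf h k \<rho>"
      unfolding smooth by (rule binormal_cdf_eq_set_integral[OF assms(1), symmetric])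
    finally show ?thesis
      by (simp only: mult.assoc mult.commute[of "G _"])
  qed
  have first: "binormal_copula u v \<rho> = (LBINT x. LBINT y. A x * B y * binormal_density x y \<gamma>)"
  proof -
    have "(LBINT y. A x * B y * binormal_density x y \<gamma>) = std_normal_density x * (A x * G x)" for x
      by (simp only: mult.assoc[of "A x"] integral_mult_right_zero inner mult.left_commute)
    then show ?thesis
      by (simp only: outer binormal_copula_def h_def k_def)
  qed

  have pos: "std_normal_density x > 0" for x
    by (simp add: normal_density_pos)
  have second_inner: "(LBINT t:{0<..<1}. A (std_normal_quantile s) * B (std_normal_quantile t) *
      binormal_copula_density s t \<gamma>) = A (std_normal_quantile s) * G (std_normal_quantile s)"
    if s: "s \<in> {0<..<1}" for s
  proof -
    define x where "x = std_normal_quantile s"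
    let ?F = "\<lambda>y. A x * B y * (binormal_density x y \<gamma> / (std_normal_density x * std_normal_density y))"
    \<comment> \<open>The weight of the substitution cancels the density of \<open>y\<close> in the
      denominator; the remaining \<open>1 / std_normal_density x\<close> will cancel against the
      right-hand side of \<open>inner\<close>.\<close>
    have F: "std_normal_density y * ?F y = A x / std_normal_density x * (B y * binormal_density x y \<gamma>)" for y
      using pos[of x] pos[of y] by (simp add: field_simps)
    \<comment> \<open>Inside the unit interval the iterated derivative is replaced by its closed
      form, a function of the quantile of \<open>t\<close> to which the substitution
      applies.\<close>
    have "(LBINT t:{0<..<1}. A x * B (std_normal_quantile t) * binormal_copula_density s t \<gamma>) =
        (LBINT t:{0<..<1}. ?F (std_normal_quantile t))"
      by (rule set_lebesgue_integral_cong)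
        (simp_all add: binormal_copula_density_eq[OF assms(5) s] x_def)
    also have "\<dots> = (LBINT y. std_normal_density y * ?F y)"
    proof (rule set_integral_std_normal_quantile)
      show "?F \<in> borel_measurable borel"
        unfolding binormal_density_def by measurable
      have "integrable lborel (\<lambda>y. B y * binormal_density x y \<gamma>)"
      proof (rule Bochner_Integration.integrable_bound)
        show "integrable lborel (\<lambda>y. std_normal_density x * normal_density (\<gamma> * x) (sqrt (1 - \<gamma>\<^sup>2)) y)"
          using sqrt_one_minus_square_pos[OF assms(5)] by simp
        show "(\<lambda>y. B y * binormal_density x y \<gamma>) \<in> borel_measurable lborel"
          unfolding binormal_density_def by measurable
        show "AE y in lborel. norm (B y * binormal_density x y \<gamma>) \<le>
            norm (std_normal_density x * normal_density (\<gamma> * x) (sqrt (1 - \<gamma>\<^sup>2)) y)"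
          unfolding binormal_density_conv_normal_density[OF assms(5), symmetric]
          using bounds(2) by (intro AE_I2) (simp add: abs_mult mult_left_le_one_le)
      qed
      then show "integrable lborel (\<lambda>y. std_normal_density y * ?F y)"
        unfolding F by simp
    qed
    also have "\<dots> = A x / std_normal_density x * (std_normal_density x * G x)"
      unfolding F by (simp only: integral_mult_right_zero inner)
    also have "\<dots> = A x * G x"
      using pos[of x] by simp
    finally show ?thesis
      by (simp only: x_def)
  qed
  have second: "binormal_copula u v \<rho> = (LBINT s:{0<..<1}. LBINT t:{0<..<1}.
      A (std_normal_quantile s) * B (std_normal_quantile t) * binormal_copula_density s t \<gamma>)"
  proof -
    have "(LBINT s:{0<..<1}. LBINT t:{0<..<1}.
        A (std_normal_quantile s) * B (std_normal_quantile t) * binormal_copula_density s t \<gamma>) =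
        (LBINT s:{0<..<1}. A (std_normal_quantile s) * G (std_normal_quantile s))"
      by (rule set_lebesgue_integral_cong) (simp_all add: second_inner)
    also have "\<dots> = (LBINT x. std_normal_density x * (A x * G x))"
    proof (rule set_integral_std_normal_quantile)
      show "integrable lborel (\<lambda>x. std_normal_density x * (A x * G x))"
      proof (rule Bochner_Integration.integrable_bound)
        show "integrable lborel std_normal_density" by simp
        show "AE x in lborel. norm (std_normal_density x * (A x * G x)) \<le> norm (std_normal_density x)"
          using bounds by (intro AE_I2) (simp add: abs_mult mult_left_le mult_le_one)
      qed measurable
    qed measurable
    finally show ?thesis
      by (simp only: outer binormal_copula_def h_def k_def)
  qed

  have third: "(LBINT s:{0<..<1}. LBINT t:{0<..<1}. deriv (\<lambda>a. binormal_copula u a \<alpha>) s *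
      deriv (\<lambda>b. binormal_copula b v \<beta>) t * binormal_copula_density s t \<gamma>) =
      (LBINT s:{0<..<1}. LBINT t:{0<..<1}.
      A (std_normal_quantile s) * B (std_normal_quantile t) * binormal_copula_density s t \<gamma>)"
  proof (intro set_lebesgue_integral_cong allI impI)
    fix s t :: real
    assume "s \<in> {0<..<1}" "t \<in> {0<..<1}"
    then have "deriv (\<lambda>a. binormal_copula u a \<alpha>) s = A (std_normal_quantile s)"
      "deriv (\<lambda>b. binormal_copula b v \<beta>) t = B (std_normal_quantile t)"
      \<comment> \<open>The derivative of the second factor is in the first argument of the copula;
        symmetry moves it to the second.\<close>
      unfolding binormal_copula_commute[OF assms(4), of _ v]
      by (simp_all only: deriv_binormal_copula assms(3,4) A_def B_def h_def k_def)
    then show "deriv (\<lambda>a. binormal_copula u a \<alpha>) s * deriv (\<lambda>b. binormal_copula b v \<beta>) t *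
        binormal_copula_density s t \<gamma> =
        A (std_normal_quantile s) * B (std_normal_quantile t) * binormal_copula_density s t \<gamma>"
      by simp
  qed simp_all
  from first second second[folded third] show ?thesis
    unfolding A_def B_def h_def k_def by (intro conjI)
qed

end
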